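(* Let $d_1\in\mathbb R\setminus\{\pm1\}$ and $d_2\in\mathbb R$. The rotational hypersurface in $\mathbb E_1^4$ parametrized by $$\Gamma^{s}(s,t,w)=\left(s\cosh t\cosh w,\ s\sinh t,\ s\cosh t\sinh w,\ d_1s+d_2\right),\qquad s\in\mathbb R\setminus\{0\},\ t,w\in\mathbb R,$$ has $L_2$-harmonic Gauss map, i.e. its unit normal vector field $N$ satisfies $L_2N=0$.
   Context: $\mathbb E_1^4$ is $\mathbb R^4$ with the Lorentzian metric $\langle\,,\rangle=-dx_1^2+dx_2^2+dx_3^2+dx_4^2$. Let $M$ be an oriented hypersurface of $\mathbb E_1^4$ with nondegenerate induced metric $g$, unit normal vector field (Gauss map) $N$, $\varepsilon=\langle N,N\rangle=\pm1$, shape operator $S=-dN$ and principal curvatures $\kappa_1,\kappa_2,\kappa_3$. Put $a_0=1$, $a_1=-(\kappa_1+\kappa_2+\kappa_3)$, $a_2=\kappa_1\kappa_2+\kappa_1\kappa_3+\kappa_2\kappa_3$, $a_3=-\kappa_1\kappa_2\kappa_3$. The Newton transformations are $P_0=I$, $P_k=a_kI+S\circ P_{k-1}$, and $L_k(\varphi)=\mathrm{tr}(P_k\circ\nabla^2\varphi)$ for $\varphi\in C^\infty(M)$, where $\nabla^2\varphi$ is the Hessian operator of $\varphi$ with respect to $g$; $L_k$ acts componentwise on $\mathbb R^4$-valued functions such as $N$. With $n=3$, $\binom{n}{k}H_k=(-\varepsilon)^ka_k$ and $C_k=\binom{n}{k+1}(-\varepsilon)^k$, the known formula used for the Gauss map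 is $L_kN=-\varepsilon C_k\big(\nabla H_{k+1}+(nH_1H_{k+1}-(n-k-1)H_{k+2})N\big)$, where $\nabla$ is the gradient of $g$ (for $k=2$ the last term has coefficient $0$). *)

theory Defs
  imports "HOL-Analysis.Analysis"
begin

definition lorentz :: "real^4 \<Rightarrow> real^4 \<Rightarrow> real" where
  "lorentz x y = - (x$1 * y$1) + x$2 * y$2 + x$3 * y$3 + x$4 * y$4"

definition pd :: "'n::finite \<Rightarrow> (real^'n \<Rightarrow> 'b::real_normed_vector) \<Rightarrow> real^'n \<Rightarrow> 'b" where
  "pd i f p = frechet_derivative f (at p) (axis i 1)"

text \<open>On an open set, being \<open>C\<^sup>\<infinity>\<close> is the same as all iterated partial
  derivatives being (Frechet) differentiable.\<close>

definition smooth_on :: "(real^'n::finite) set \<Rightarrow> (real^'n \<Rightarrow> 'b::real_normed_vector) \<Rightarrow> bool" where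
  "smooth_on U f \<longleftrightarrow> open U \<and> (\<forall>is. foldr pd is f differentiable_on U)"

text \<open>A hypersurface is given by a parametrization \<open>X\<close> on an open set \<open>U\<close> of parameters, and
  functions and fields on it are functions of the parameters. An operator on tangent
  spaces is represented by its matrix in the coordinate frame: column \<open>j\<close> holds the
  components of the image of \<open>pd j X p\<close>.\<close>

definition metric :: "(real^3 \<Rightarrow> real^4) \<Rightarrow> real^3 \<Rightarrow> real^3^3" where
  "metric X p = (\<chi> i j. lorentz (pd i X p) (pd j X p))"

text \<open>Nondegeneracy of the metric forces the partial derivatives of \<open>X\<close> to be linearly
  independent, so \<open>X\<close> is an immersion.\<close>

definition nondegenerate_hypersurface :: "(real^3) set \<Rightarrow> (real^3 \<Rightarrow> real^4) \<Rightarrow> bool" where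
  "nondegenerate_hypersurface U X \<longleftrightarrow>
     smooth_on U X \<and> (\<forall>p\<in>U. det (metric X p) \<noteq> 0)"

definition gauss_map :: "(real^3) set \<Rightarrow> (real^3 \<Rightarrow> real^4) \<Rightarrow> (real^3 \<Rightarrow> real^4) \<Rightarrow> bool" where
  "gauss_map U X N \<longleftrightarrow>
     smooth_on U N \<and>
     (\<forall>p\<in>U. \<forall>i. lorentz (N p) (pd i X p) = 0) \<and>
     (\<exists>\<epsilon>\<in>{1, -1}. \<forall>p\<in>U. lorentz (N p) (N p) = \<epsilon>)"

definition shape_operator :: "(real^3 \<Rightarrow> real^4) \<Rightarrow> (real^3 \<Rightarrow> real^4) \<Rightarrow> real^3 \<Rightarrow> real^3^3" where
  "shape_operator X N p =
     (THE A. \<forall>j. - pd j N p = (\<Sum>i\<in>UNIV. A$i$j *\<^sub>R pd i X p))"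

text \<open>The principal curvatures are the eigenvalues of the shape operator, repeated according to
  algebraic multiplicity. For an indefinite metric they may be non-real or the operator may fail
  to be diagonalizable, hence complex roots of the characteristic polynomial. Their order is
  irrelevant below, and their elementary symmetric functions are real.\<close>

definition principal_curvatures ::
  "(real^3 \<Rightarrow> real^4) \<Rightarrow> (real^3 \<Rightarrow> real^4) \<Rightarrow> real^3 \<Rightarrow> 3 \<Rightarrow> complex" where
  "principal_curvatures X N p =
     (SOME \<kappa>. \<forall>z. det (mat z - map_matrix complex_of_real (shape_operator X N p))
                   = (\<Prod>i\<in>UNIV. (z - \<kappa> i)))"

definition curv_coeff :: "(real^3 \<Rightarrow> real^4) \<Rightarrow> (real^3 \<Rightarrow> real^4) \<Rightarrow> real^3 \<Rightarrow> nat \<Rightarrow> real" where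
  "curv_coeff X N p k = (let \<kappa> = principal_curvatures X N p in
     if k = 0 then 1
     else if k = 1 then - Re (\<kappa> 1 + \<kappa> 2 + \<kappa> 3)
     else if k = 2 then Re (\<kappa> 1 * \<kappa> 2 + \<kappa> 1 * \<kappa> 3 + \<kappa> 2 * \<kappa> 3)
     else if k = 3 then - Re (\<kappa> 1 * \<kappa> 2 * \<kappa> 3)
     else 0)"

primrec newton :: "(real^3 \<Rightarrow> real^4) \<Rightarrow> (real^3 \<Rightarrow> real^4) \<Rightarrow> real^3 \<Rightarrow> nat \<Rightarrow> real^3^3" where
  "newton X N p 0 = mat 1"
| "newton X N p (Suc k) =
     mat (curv_coeff X N p (Suc k)) + shape_operator X N p ** newton X N p k"

definition grad :: "(real^3 \<Rightarrow> real^4) \<Rightarrow> (real^3 \<Rightarrow> real) \<Rightarrow> real^3 \<Rightarrow> real^3" where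
  "grad X \<phi> p = (\<chi> i. \<Sum>j\<in>UNIV. matrix_inv (metric X p) $ i $ j * pd j \<phi> p)"

definition christoffel :: "(real^3 \<Rightarrow> real^4) \<Rightarrow> real^3 \<Rightarrow> 3 \<Rightarrow> 3 \<Rightarrow> 3 \<Rightarrow> real" where
  "christoffel X p i j k = 1/2 * (\<Sum>l\<in>UNIV. matrix_inv (metric X p) $ i $ l *
     (pd j (\<lambda>q. metric X q $ k $ l) p + pd k (\<lambda>q. metric X q $ j $ l) p
      - pd l (\<lambda>q. metric X q $ j $ k) p))"

text \<open>Levi-Civita covariant derivative, in the direction of the \<open>j\<close>-th coordinate field, of the
  vector field with components \<open>V\<close>.\<close>

definition cov_deriv ::
  "(real^3 \<Rightarrow> real^4) \<Rightarrow> 3 \<Rightarrow> (real^3 \<Rightarrow> real^3) \<Rightarrow> real^3 \<Rightarrow> real^3" where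
  "cov_deriv X j V p =
     (\<chi> i. pd j (\<lambda>q. V q $ i) p + (\<Sum>k\<in>UNIV. christoffel X p i j k * V p $ k))"

definition hessian_op :: "(real^3 \<Rightarrow> real^4) \<Rightarrow> (real^3 \<Rightarrow> real) \<Rightarrow> real^3 \<Rightarrow> real^3^3" where
  "hessian_op X \<phi> p = (\<chi> i j. cov_deriv X j (grad X \<phi>) p $ i)"

definition L_op ::
  "nat \<Rightarrow> (real^3 \<Rightarrow> real^4) \<Rightarrow> (real^3 \<Rightarrow> real^4) \<Rightarrow> (real^3 \<Rightarrow> real) \<Rightarrow> real^3 \<Rightarrow> real" where
  "L_op k X N \<phi> p = trace (newton X N p k ** hessian_op X \<phi> p)"

definition L_op_vec ::
  "nat \<Rightarrow> (real^3 \<Rightarrow> real^4) \<Rightarrow> (real^3 \<Rightarrow> real^4) \<Rightarrow> (real^3 \<Rightarrow> real^4) \<Rightarrow> real^3 \<Rightarrow> real^4" where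
  "L_op_vec k X N F p = (\<chi> a. L_op k X N (\<lambda>q. F q $ a) p)"

definition \<Gamma>s :: "real \<Rightarrow> real \<Rightarrow> real^3 \<Rightarrow> real^4" where
  "\<Gamma>s d1 d2 p = (let s = p$1; t = p$2; w = p$3 in
     vector [s * cosh t * cosh w, s * sinh t, s * cosh t * sinh w, d1 * s + d2])"

definition \<Gamma>s_dom :: "(real^3) set" where
  "\<Gamma>s_dom = {p. p$1 \<noteq> 0}"

end

theory Submission
  imports Defs
begin

text \<open>Write the hypersurface as \<open>(s v, d1 s + d2)\<close>, where \<open>v\<close> runs through the hyperbolic plane
  \<open>\<langle>v, v\<rangle> = -1\<close> of \<open>E_1^3\<close>. The metric is \<open>diag (d1^2 - 1, s^2, s^2 cosh^2 t)\<close> and every Gauss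
  map is a locally constant multiple of \<open>(d1 v, 1)\<close>, hence independent of \<open>s\<close>. So the shape
  operator is \<open>diag (0, k, k)\<close> and \<open>P_2 = diag (k^2, 0, 0)\<close>, which reduces \<open>L_2\<close> to a multiple of
  the second derivative along the affinely parametrized geodesic rulings \<open>s\<close>, and that
  annihilates \<open>N\<close>.\<close>

section \<open>Smooth maps\<close>

lemma pd_eq:
  assumes "(f has_derivative f') (at p)"
  shows "pd i f p = f' (axis i 1)"
  using frechet_derivative_at[OF assms] by (simp add: pd_def)

text \<open>Differentiability is not assumed: \<open>f\<close> and \<open>g\<close> have the same
  candidate derivatives at \<open>p\<close>, so the choice in \<open>frechet_derivative\<close>
  picks the same one.\<close>

lemma pd_cong_open:
  assumes "open U" "p \<in> U" "\<And>q. q \<in> U \<Longrightarrow> f q = g q"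
  shows "pd i f p = pd i g p"
proof -
  have "(f has_derivative D) (at p) \<longleftrightarrow> (g has_derivative D) (at p)" for D
    using has_derivative_transform_within_open[of f D p UNIV U g]
      has_derivative_transform_within_open[of g D p UNIV U f] assms by auto
  then show ?thesis by (simp add: pd_def frechet_derivative_def)
qed

lemma differentiable_on_open_has_derivative:
  assumes "f differentiable_on U" "open U" "p \<in> U"
  shows "(f has_derivative frechet_derivative f (at p)) (at p)"
  using assms differentiable_on_eq_differentiable_at frechet_derivative_works by blast

text \<open>Coinduction principle: by induction on the index list, every iterated partial derivative
  agrees on \<open>U\<close> with a member of \<open>F\<close>. Agreement on \<open>U\<close>
  suffices because \<open>U\<close> is open, so nothing has to be controlled outside it.\<close>

lemma smooth_on_coinduct:
  assumes "open U" "f \<in> F"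
    and diff: "\<And>f. f \<in> F \<Longrightarrow> f differentiable_on U"
    and step: "\<And>f i. f \<in> F \<Longrightarrow> \<exists>g\<in>F. \<forall>p\<in>U. pd i f p = g p"
  shows "smooth_on U f"
proof -
  have *: "\<exists>g\<in>F. \<forall>p\<in>U. foldr pd is f p = g p" for "is"
  proof (induction "is")
    case Nil
    then show ?case using \<open>f \<in> F\<close> by auto
  next
    case (Cons i "is")
    then obtain g where g: "g \<in> F" "\<forall>p\<in>U. foldr pd is f p = g p" by blast
    obtain h where h: "h \<in> F" "\<forall>p\<in>U. pd i g p = h p" using step[OF g(1)] by blast
    have "\<forall>p\<in>U. pd i (foldr pd is f) p = h p"
      using pd_cong_open[OF \<open>open U\<close>, of _ "foldr pd is f" g] g h by simp
    then show ?case using h by auto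
  qed
  have "foldr pd is f differentiable_on U" for "is"
  proof -
    obtain g where g: "g \<in> F" "\<And>p. p \<in> U \<Longrightarrow> foldr pd is f p = g p"
      using * by blast
    show ?thesis
      unfolding differentiable_on_def
    proof
      fix p assume "p \<in> U"
      then have "g differentiable (at p within U)"
        using diff[OF g(1)] by (simp add: differentiable_on_def)
      then show "foldr pd is f differentiable (at p within U)"
        by (rule differentiable_transform_within[OF _ zero_less_one \<open>p \<in> U\<close>]) (simp add: g(2))
    qed
  qed
  then show ?thesis using \<open>open U\<close> by (auto simp: smooth_on_def)
qed

lemma smooth_on_imp_differentiable_on:
  assumes "smooth_on U f"
  shows "f differentiable_on U"
proof -
  have "foldr pd [] f differentiable_on U" using assms unfolding smooth_on_def by blast
  then show ?thesis by simp
qed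

lemma smooth_on_pd:
  assumes "smooth_on U f"
  shows "smooth_on U (pd i f)"
proof -
  \<comment> \<open>\<open>foldr\<close> applies the last index first, so an additional innermost
    derivative is appended at the end of the list.\<close>
  have "foldr pd is (pd i f) = foldr pd (is @ [i]) f" for "is" by simp
  then show ?thesis using assms unfolding smooth_on_def by metis
qed

lemma smooth_on_has_derivative:
  assumes "smooth_on U f" "p \<in> U"
  shows "(f has_derivative frechet_derivative f (at p)) (at p)"
  using assms differentiable_on_open_has_derivative smooth_on_imp_differentiable_on
  unfolding smooth_on_def by blast

section \<open>Closure properties of smooth maps\<close>

lemma pd_const [simp]: "pd i (\<lambda>p. c) p = 0"
  by (rule pd_eq) (rule has_derivative_const)

lemma smooth_on_const:
  assumes "open U"
  shows "smooth_on U (\<lambda>p. c)"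
proof (rule smooth_on_coinduct[where F = "range (\<lambda>c p. c)"])
  fix f :: "real^'a \<Rightarrow> 'b" and i
  assume "f \<in> range (\<lambda>c p. c)"
  then obtain c where f: "f = (\<lambda>p. c)" by (rule rangeE)
  show "f differentiable_on U" by (simp add: f)
  show "\<exists>g\<in>range (\<lambda>c p. c). \<forall>p\<in>U. pd i f p = g p"
    by (rule bexI[of _ "\<lambda>p. 0"]) (simp_all add: f)
qed (rule assms rangeI)+

text \<open>Partial derivatives commute with \<open>L\<close>, so the maps \<open>L\<close> after a
  smooth map form a closed family. With \<open>L\<close> a scaling of a fixed vector this passes
  from scalar coordinates to vector-valued maps.\<close>

lemma smooth_on_bounded_linear:
  assumes "bounded_linear L" "smooth_on U f"
  shows "smooth_on U (\<lambda>p. L (f p))"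
proof (rule smooth_on_coinduct[where F = "{\<lambda>p. L (f p) |f. smooth_on U f}"])
  show "open U" using assms by (simp add: smooth_on_def)
next
  fix g i assume "g \<in> {\<lambda>p. L (f p) |f. smooth_on U f}"
  then obtain f where f: "g = (\<lambda>p. L (f p))" "smooth_on U f" by blast
  have D: "(g has_derivative (\<lambda>h. L (frechet_derivative f (at p) h))) (at p)" if "p \<in> U" for p
    unfolding f by (rule bounded_linear.has_derivative[OF assms(1)
      smooth_on_has_derivative[OF f(2) that]])
  show "g differentiable_on U"
    by (rule differentiable_at_imp_differentiable_on[OF differentiableI[OF D]])
  have "\<forall>p\<in>U. pd i g p = L (pd i f p)"
    using pd_eq[OF D] by (simp add: pd_def)
  then show "\<exists>h\<in>{\<lambda>p. L (f p) |f. smooth_on U f}. \<forall>p\<in>U. pd i g p = h p"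
    by (intro bexI[of _ "\<lambda>p. L (pd i f p)"] CollectI exI[of _ "pd i f"]
        conjI refl smooth_on_pd f(2))
next
  show "(\<lambda>p. L (f p)) \<in> {\<lambda>p. L (f p) |f. smooth_on U f}"
    by (intro CollectI exI[of _ f] conjI refl assms)
qed

lemma smooth_on_add:
  assumes "smooth_on U f" "smooth_on U g"
  shows "smooth_on U (\<lambda>p. f p + g p)"
proof (rule smooth_on_coinduct[where F = "{\<lambda>p. f p + g p |f g. smooth_on U f \<and> smooth_on U g}"])
  show "open U" using assms by (simp add: smooth_on_def)
next
  fix k i assume "k \<in> {\<lambda>p. f p + g p |f g. smooth_on U f \<and> smooth_on U g}"
  then obtain f g where k: "k = (\<lambda>p. f p + g p)" and fg: "smooth_on U f" "smooth_on U g" by blast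
  have D: "(k has_derivative
      (\<lambda>h. frechet_derivative f (at p) h + frechet_derivative g (at p) h)) (at p)"
    if "p \<in> U" for p
    unfolding k by (intro has_derivative_add smooth_on_has_derivative[OF _ that] fg)
  show "k differentiable_on U"
    by (rule differentiable_at_imp_differentiable_on[OF differentiableI[OF D]])
  have "\<forall>p\<in>U. pd i k p = pd i f p + pd i g p"
    using pd_eq[OF D] by (simp add: pd_def)
  then show "\<exists>h\<in>{\<lambda>p. f p + g p |f g. smooth_on U f \<and> smooth_on U g}. \<forall>p\<in>U. pd i k p = h p"
    by (intro bexI[of _ "\<lambda>p. pd i f p + pd i g p"] CollectI exI[of _ "pd i f"]
        exI[of _ "pd i g"] conjI refl smooth_on_pd fg)
next
  show "(\<lambda>p. f p + g p) \<in> {\<lambda>p. f p + g p |f g. smooth_on U f \<and> smooth_on U g}"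
    by (intro CollectI exI[of _ f] exI[of _ g] conjI refl assms)
qed

text \<open>The Leibniz rule turns a product into a sum of two products. Closing the products under
  addition gives a family stable under \<open>pd\<close>, as coinduction requires.\<close>

inductive_set sums_of_products :: "(real^'n::finite) set \<Rightarrow> (real^'n \<Rightarrow> real) set"
  for U where
  prod: "smooth_on U f \<Longrightarrow> smooth_on U g \<Longrightarrow> (\<lambda>p. f p * g p) \<in> sums_of_products U"
| add: "f \<in> sums_of_products U \<Longrightarrow> g \<in> sums_of_products U \<Longrightarrow>
    (\<lambda>p. f p + g p) \<in> sums_of_products U"

lemma sums_of_products_pd:
  assumes "k \<in> sums_of_products U" "open U"
  shows "k differentiable_on U \<and> (\<forall>i. \<exists>h\<in>sums_of_products U. \<forall>p\<in>U. pd i k p = h p)"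
  using assms(1)
proof induction
  case (prod f g)
  have D: "((\<lambda>p. f p * g p) has_derivative (\<lambda>h. f p * frechet_derivative g (at p) h
      + frechet_derivative f (at p) h * g p)) (at p)" if "p \<in> U" for p
    by (intro has_derivative_mult smooth_on_has_derivative[OF _ that] prod)
  have "\<forall>p\<in>U. pd i (\<lambda>p. f p * g p) p = f p * pd i g p + pd i f p * g p" for i
    using pd_eq[OF D] by (simp add: pd_def)
  moreover have "(\<lambda>p. f p * pd i g p + pd i f p * g p) \<in> sums_of_products U" for i
    using prod smooth_on_pd by (intro sums_of_products.intros)
  moreover have "(\<lambda>p. f p * g p) differentiable_on U"
    by (rule differentiable_at_imp_differentiable_on[OF differentiableI[OF D]])
  ultimately show ?case by (intro conjI allI bexI)
next
  case (add f g)
  have D: "((\<lambda>p. f p + g p) has_derivative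
      (\<lambda>h. frechet_derivative f (at p) h + frechet_derivative g (at p) h)) (at p)"
    if "p \<in> U" for p
    using add.IH
    by (intro has_derivative_add differentiable_on_open_has_derivative[OF _ \<open>open U\<close> that]) auto
  have "\<exists>h\<in>sums_of_products U. \<forall>p\<in>U. pd i (\<lambda>p. f p + g p) p = h p" for i
  proof -
    obtain f' g' where fg: "f' \<in> sums_of_products U" "g' \<in> sums_of_products U"
      "\<forall>p\<in>U. pd i f p = f' p" "\<forall>p\<in>U. pd i g p = g' p"
      using add.IH by meson
    have "\<forall>p\<in>U. pd i (\<lambda>p. f p + g p) p = f' p + g' p"
      using pd_eq[OF D] fg by (simp add: pd_def)
    then show ?thesis using sums_of_products.add[OF fg(1,2)] by (intro bexI)
  qed
  moreover have "(\<lambda>p. f p + g p) differentiable_on U"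
    by (rule differentiable_at_imp_differentiable_on[OF differentiableI[OF D]])
  ultimately show ?case by simp
qed

lemma smooth_on_mult:
  fixes f g :: "real^'n::finite \<Rightarrow> real"
  assumes "smooth_on U f" "smooth_on U g"
  shows "smooth_on U (\<lambda>p. f p * g p)"
proof (rule smooth_on_coinduct[where F = "sums_of_products U"])
  show "open U" using assms by (simp add: smooth_on_def)
  then show "k differentiable_on U" and "\<exists>h\<in>sums_of_products U. \<forall>p\<in>U. pd i k p = h p"
    if "k \<in> sums_of_products U" for k i
    using sums_of_products_pd[OF that] by blast+
qed (use assms in \<open>rule sums_of_products.prod\<close>)

section \<open>Coordinate functions and hyperbolic functions of them\<close>

lemma has_derivative_nth: "((\<lambda>p. p $ i) has_derivative (\<lambda>h. h $ i)) (at p)"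
  by (rule bounded_linear_imp_has_derivative) (rule bounded_linear_vec_nth)

lemma smooth_on_nth:
  assumes "open U"
  shows "smooth_on U (\<lambda>p. p $ i)"
proof (rule smooth_on_coinduct[where F = "insert (\<lambda>p. p $ i) (range (\<lambda>c p. c))"])
  fix f :: "real^'a \<Rightarrow> real" and j
  assume "f \<in> insert (\<lambda>p. p $ i) (range (\<lambda>c p. c))"
  then consider "f = (\<lambda>p. p $ i)" | c where "f = (\<lambda>p. c)" by blast
  note cases = this
  show "f differentiable_on U"
    using cases
    by cases (auto intro: differentiable_at_imp_differentiable_on differentiableI has_derivative_nth)
  show "\<exists>g\<in>insert (\<lambda>p. p $ i) (range (\<lambda>c p. c)). \<forall>p\<in>U. pd j f p = g p"
    using cases
  proof cases
    case 1
    then show ?thesis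
      by (intro bexI[of _ "\<lambda>p. axis j 1 $ i"]) (simp_all add: pd_eq[OF has_derivative_nth])
  next
    case 2
    then show ?thesis by (intro bexI[of _ "\<lambda>p. 0"]) simp_all
  qed
qed (rule assms insertI1)+

lemmas [derivative_intros] =
  has_field_derivative_cosh[OF DERIV_ident, THEN DERIV_compose_FDERIV]
  has_field_derivative_sinh[OF DERIV_ident, THEN DERIV_compose_FDERIV]

text \<open>Both functions are treated at once since each is the derivative of the other; the factor
  \<open>c\<close> in \<open>F\<close> absorbs the entry of \<open>axis j 1\<close> produced by the
  chain rule.\<close>

lemma smooth_on_cosh_sinh_nth:
  fixes U :: "(real^'n::finite) set"
  assumes "open U"
  shows "smooth_on U (\<lambda>p. cosh (p $ i))" and "smooth_on U (\<lambda>p. sinh (p $ i))"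
proof -
  define F :: "(real^'n \<Rightarrow> real) set"
    where "F = (\<Union>c. {\<lambda>p. c * cosh (p $ i), \<lambda>p. c * sinh (p $ i)})"
  have D: "((\<lambda>p::real^'n. c * cosh (p $ i)) has_derivative (\<lambda>h. c * h $ i * sinh (p $ i))) (at p)"
    "((\<lambda>p::real^'n. c * sinh (p $ i)) has_derivative (\<lambda>h. c * h $ i * cosh (p $ i))) (at p)"
    for c p by (auto intro!: derivative_eq_intros has_derivative_nth)
  have "smooth_on U f" if "f \<in> F" for f
  proof (rule smooth_on_coinduct[OF assms that])
    fix g j assume "g \<in> F"
    then show "g differentiable_on U"
      unfolding F_def
      by (auto intro!: differentiable_at_imp_differentiable_on D[THEN differentiableI])
    have "pd j (\<lambda>p. c * cosh (p $ i)) = (\<lambda>p. (c * axis j 1 $ i) * sinh (p $ i))"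
      "pd j (\<lambda>p. c * sinh (p $ i)) = (\<lambda>p. (c * axis j 1 $ i) * cosh (p $ i))" for c
      by (simp_all add: fun_eq_iff pd_eq[OF D(1)] pd_eq[OF D(2)])
    then have "pd j g \<in> F"
      using \<open>g \<in> F\<close> unfolding F_def by blast
    then show "\<exists>h\<in>F. \<forall>p\<in>U. pd j g p = h p" by blast
  qed
  moreover have "(\<lambda>p. 1 * cosh (p $ i)) \<in> F" "(\<lambda>p. 1 * sinh (p $ i)) \<in> F"
    unfolding F_def by blast+
  ultimately have "smooth_on U (\<lambda>p. 1 * cosh (p $ i))" "smooth_on U (\<lambda>p. 1 * sinh (p $ i))"
    by blast+
  then show "smooth_on U (\<lambda>p. cosh (p $ i))" "smooth_on U (\<lambda>p. sinh (p $ i))"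
    by simp_all
qed

section \<open>Linear algebra\<close>

lemma vector_4:
  "(vector [a, b, c, d] :: 'a::zero^4) $ 1 = a"
  "(vector [a, b, c, d] :: 'a^4) $ 2 = b"
  "(vector [a, b, c, d] :: 'a^4) $ 3 = c"
  "(vector [a, b, c, d] :: 'a^4) $ 4 = d"
  by (simp_all add: vector_def)

text \<open>Writes a vector as scalar functions times fixed vectors, the form to which the
  derivative and smoothness rules apply.\<close>

lemma vector_4_eq:
  "(vector [a, b, c, d] :: real^4) =
    a *\<^sub>R axis 1 1 + b *\<^sub>R axis 2 1 + c *\<^sub>R axis 3 1 + d *\<^sub>R axis 4 1"
  by (simp add: vec_eq_iff forall_4 vector_4 axis_def)

lemma prod_3: "prod f (UNIV :: 3 set) = f 1 * f 2 * f 3"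
  unfolding UNIV_3 by (simp add: ac_simps)

text \<open>Entry (i, j) of \<open>matrix_inv A ** A\<close> is a single product with
  \<open>A $ j $ j\<close>, and entry (j, j) of \<open>A ** matrix_inv A\<close> shows that this
  factor is nonzero.\<close>

lemma matrix_inv_diagonal:
  fixes A :: "real^'n^'n"
  assumes "invertible A" "\<And>i j. i \<noteq> j \<Longrightarrow> A $ i $ j = 0" "i \<noteq> j"
  shows "matrix_inv A $ i $ j = 0"
proof -
  have "A ** matrix_inv A = mat 1 \<and> matrix_inv A ** A = mat 1"
    using assms(1) unfolding invertible_def matrix_inv_def by (rule someI_ex)
  moreover have "(matrix_inv A ** A) $ i $ k = matrix_inv A $ i $ k * A $ k $ k"
    and "(A ** matrix_inv A) $ k $ k = A $ k $ k * matrix_inv A $ k $ k" for k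
  proof -
    have "(matrix_inv A ** A) $ i $ k = (\<Sum>l\<in>UNIV. matrix_inv A $ i $ l * A $ l $ k)"
      by (simp add: matrix_matrix_mult_def)
    also have "\<dots> = (\<Sum>l\<in>UNIV. if l = k then matrix_inv A $ i $ l * A $ l $ k else 0)"
      by (rule sum.cong) (simp_all add: assms(2))
    finally show "(matrix_inv A ** A) $ i $ k = matrix_inv A $ i $ k * A $ k $ k" by simp
    have "(A ** matrix_inv A) $ k $ k = (\<Sum>l\<in>UNIV. A $ k $ l * matrix_inv A $ l $ k)"
      by (simp add: matrix_matrix_mult_def)
    also have "\<dots> = (\<Sum>l\<in>UNIV. if l = k then A $ k $ l * matrix_inv A $ l $ k else 0)"
      by (rule sum.cong) (simp_all add: assms(2))
    finally show "(A ** matrix_inv A) $ k $ k = A $ k $ k * matrix_inv A $ k $ k" by simp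
  qed
  ultimately have "matrix_inv A $ i $ j * A $ j $ j = mat 1 $ i $ j"
    "A $ j $ j * matrix_inv A $ j $ j = mat 1 $ j $ j"
    by metis+
  then have "matrix_inv A $ i $ j * A $ j $ j = 0" "A $ j $ j \<noteq> 0"
    using \<open>i \<noteq> j\<close> by (auto simp: mat_def)
  then show ?thesis by auto
qed

text \<open>Comparing the cubics at \<open>z = 0, 1, -1\<close> determines their coefficients.\<close>

lemma monic_cubic_coeffs_unique:
  fixes a b c a' b' c' :: complex
  assumes "\<And>z. (z - a) * (z - b) * (z - c) = (z - a') * (z - b') * (z - c')"
  shows "a + b + c = a' + b' + c'"
    and "a * b + a * c + b * c = a' * b' + a' * c' + b' * c'"
    and "a * b * c = a' * b' * c'"
proof -
  have expand: "(z - a) * (z - b) * (z - c) =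
      z^3 - (a + b + c) * z^2 + (a * b + a * c + b * c) * z - a * b * c" for z a b c :: complex
    by (simp add: algebra_simps power2_eq_square power3_eq_cube)
  note * = assms[unfolded expand]
  show 3: "a * b * c = a' * b' * c'" using *[of 0] by simp
  \<comment> \<open>Subtracting the values at 1 and -1 cancels the quadratic and constant terms and
    isolates twice the linear coefficient.\<close>
  have "2 * (a * b + a * c + b * c) = 2 * (a' * b' + a' * c' + b' * c')"
    using *[of 1] *[of "-1"] 3 by (simp del: distrib_left_numeral) algebra
  then show 2: "a * b + a * c + b * c = a' * b' + a' * c' + b' * c'"
    unfolding mult_cancel_left by simp
  have "- a - c - b = - a' - c' - b'" using *[of 1] 2 3 by simp
  then show "a + b + c = a' + b' + c'" by algebra
qed

section \<open>Shape operator and Newton transformations\<close>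

lemma lorentz_sum_left: "lorentz (\<Sum>i\<in>I. a i *\<^sub>R v i) y = (\<Sum>i\<in>I. a i * lorentz (v i) y)"
  by (simp add: lorentz_def sum_distrib_left sum_distrib_right sum.distrib sum_subtractf
      algebra_simps sum_negf)

text \<open>Uniqueness behind the definite description: pairing the defining equation with
  \<open>pd k X p\<close> turns it into an equation for \<open>transpose A ** metric X p\<close>,
  and the metric can be cancelled.\<close>

lemma shape_operator_eqI:
  assumes "det (metric X p) \<noteq> 0"
    and A: "\<And>j. - pd j N p = (\<Sum>i\<in>UNIV. A $ i $ j *\<^sub>R pd i X p)"
  shows "shape_operator X N p = A"
  unfolding shape_operator_def
proof (rule the_equality)
  fix B :: "real^3^3"
  assume B: "\<forall>j. - pd j N p = (\<Sum>i\<in>UNIV. B $ i $ j *\<^sub>R pd i X p)"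
  have "transpose B ** metric X p = transpose A ** metric X p"
  proof -
    have "(transpose C ** metric X p) $ j $ k = lorentz (- pd j N p) (pd k X p)"
      if "\<forall>j. - pd j N p = (\<Sum>i\<in>UNIV. C $ i $ j *\<^sub>R pd i X p)" for C :: "real^3^3" and j k
      using that
      by (simp add: lorentz_sum_left matrix_matrix_mult_def transpose_def metric_def)
    then show ?thesis using A B by (simp add: vec_eq_iff)
  qed
  moreover have "invertible (metric X p)" using assms(1) by (simp add: invertible_det_nz)
  ultimately have "transpose B = transpose A"
    by (metis invertible_def matrix_mul_assoc matrix_mul_rid)
  then show "B = A" by (metis transpose_transpose)
qed (use A in blast)

text \<open>For S = diag(0, k, k) one has a_1 = -2k and a_2 = k^2, so P_1 = diag(-2k, -k, -k) and
  P_2 = k^2 I + S P_1 = diag(k^2, 0, 0).\<close>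

lemma newton_2_of_umbilic_block:
  assumes S: "shape_operator X N p = (\<chi> i j. if i = j \<and> i \<noteq> 1 then k else 0)"
  shows "newton X N p 2 = (\<chi> i j. if i = 1 \<and> j = 1 then k\<^sup>2 else 0)"
proof -
  define \<kappa> where "\<kappa> = principal_curvatures X N p"
  have char: "det (mat z - map_matrix complex_of_real (shape_operator X N p)) =
      (z - 0) * (z - of_real k) * (z - of_real k)" for z
  proof -
    have "(mat z - map_matrix complex_of_real (shape_operator X N p)) $ i $ j =
        (if i = j then if i = 1 then z else z - of_real k else 0)" for i j
      by (simp add: S mat_def map_matrix_def)
    then show ?thesis by (simp add: det_3)
  qed
  \<comment> \<open>A factorization exists, so the chosen \<open>\<kappa>\<close> is one too. Its
    order is unknown, hence only its elementary symmetric functions are extracted.\<close>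
  have "\<exists>\<kappa>. \<forall>z. det (mat z - map_matrix complex_of_real (shape_operator X N p)) =
      (\<Prod>i\<in>(UNIV :: 3 set). (z - \<kappa> i))"
    by (rule exI[of _ "\<lambda>i. if i = 1 then 0 else of_real k"]) (unfold char prod_3, simp)
  from someI_ex[OF this, folded principal_curvatures_def \<kappa>_def]
  have "\<forall>z. det (mat z - map_matrix complex_of_real (shape_operator X N p)) =
      (\<Prod>i\<in>UNIV. (z - \<kappa> i))" .
  then have "(z - \<kappa> 1) * (z - \<kappa> 2) * (z - \<kappa> 3) = (z - 0) * (z - of_real k) * (z - of_real k)" for z
    unfolding char prod_3 by simp
  from monic_cubic_coeffs_unique(1,2)[OF this]
  have e: "\<kappa> 1 + \<kappa> 2 + \<kappa> 3 = of_real (2 * k)"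
    "\<kappa> 1 * \<kappa> 2 + \<kappa> 1 * \<kappa> 3 + \<kappa> 2 * \<kappa> 3 = of_real (k\<^sup>2)"
    by (simp_all add: power2_eq_square)
  have "curv_coeff X N p 1 = - Re (of_real (2 * k))" "curv_coeff X N p 2 = Re (of_real (k\<^sup>2))"
    unfolding curv_coeff_def Let_def \<kappa>_def[symmetric] e[symmetric] by simp_all
  then show ?thesis
    by (simp add: numeral_2_eq_2 S vec_eq_iff forall_3 matrix_matrix_mult_def sum_3 mat_def
        power2_eq_square)
qed

section \<open>The rotational hypersurface\<close>

text \<open>The normal field (d1 v, 1), not of unit length. Its fourth coordinate is 1, so a
  multiple \<open>n\<close> of it has factor \<open>n$4\<close>.\<close>

definition conormal :: "real \<Rightarrow> real^3 \<Rightarrow> real^4" where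
  "conormal d1 p = vector
    [d1 * cosh (p$2) * cosh (p$3), d1 * sinh (p$2), d1 * cosh (p$2) * sinh (p$3), 1]"

lemma \<Gamma>s_eq:
  "\<Gamma>s d1 d2 p = vector [p$1 * cosh (p$2) * cosh (p$3), p$1 * sinh (p$2),
    p$1 * cosh (p$2) * sinh (p$3), d1 * p$1 + d2]"
  by (simp add: \<Gamma>s_def Let_def)

lemma has_derivative_\<Gamma>s:
  "(\<Gamma>s d1 d2 has_derivative (\<lambda>h.
     h$1 *\<^sub>R vector [cosh (p$2) * cosh (p$3), sinh (p$2), cosh (p$2) * sinh (p$3), d1] +
     h$2 *\<^sub>R vector [p$1 * sinh (p$2) * cosh (p$3), p$1 * cosh (p$2), p$1 * sinh (p$2) * sinh (p$3), 0] +
     h$3 *\<^sub>R vector [p$1 * cosh (p$2) * sinh (p$3), 0, p$1 * cosh (p$2) * cosh (p$3), 0])) (at p)"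
  unfolding \<Gamma>s_eq[abs_def] vector_4_eq
  by (auto intro!: derivative_eq_intros has_derivative_nth
      simp: fun_eq_iff vec_eq_iff forall_4 axis_def algebra_simps)

lemma pd_\<Gamma>s:
  "pd 1 (\<Gamma>s d1 d2) p =
    vector [cosh (p$2) * cosh (p$3), sinh (p$2), cosh (p$2) * sinh (p$3), d1]"
  "pd 2 (\<Gamma>s d1 d2) p =
    vector [p$1 * sinh (p$2) * cosh (p$3), p$1 * cosh (p$2), p$1 * sinh (p$2) * sinh (p$3), 0]"
  "pd 3 (\<Gamma>s d1 d2) p =
    vector [p$1 * cosh (p$2) * sinh (p$3), 0, p$1 * cosh (p$2) * cosh (p$3), 0]"
  by (simp_all add: pd_eq[OF has_derivative_\<Gamma>s] axis_def)

section \<open>The normal direction and the induced metric\<close>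

lemma has_derivative_conormal:
  "(conormal d1 has_derivative (\<lambda>h.
     h$2 *\<^sub>R vector [d1 * sinh (p$2) * cosh (p$3), d1 * cosh (p$2), d1 * sinh (p$2) * sinh (p$3), 0] +
     h$3 *\<^sub>R vector [d1 * cosh (p$2) * sinh (p$3), 0, d1 * cosh (p$2) * cosh (p$3), 0])) (at p)"
  unfolding conormal_def[abs_def] vector_4_eq
  by (auto intro!: derivative_eq_intros has_derivative_nth
      simp: fun_eq_iff vec_eq_iff forall_4 axis_def algebra_simps)

lemma lorentz_conormal: "lorentz (conormal d1 p) (conormal d1 p) = 1 - d1\<^sup>2"
proof -
  have "lorentz (conormal d1 p) (conormal d1 p) =
      - d1\<^sup>2 * cosh (p$2) ^ 2 * cosh (p$3) ^ 2 + d1\<^sup>2 * sinh (p$2) ^ 2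
     + d1\<^sup>2 * cosh (p$2) ^ 2 * sinh (p$3) ^ 2 + 1"
    by (simp add: lorentz_def conormal_def vector_4 power2_eq_square algebra_simps)
  then show ?thesis by (simp add: cosh_square_eq algebra_simps)
qed

text \<open>Along s the product is d1 \<langle>v, v\<rangle> + d1 = 0; along t and w it vanishes
  because derivatives of v are orthogonal to v.\<close>

lemma lorentz_conormal_pd: "lorentz (conormal d1 p) (pd i (\<Gamma>s d1 d2) p) = 0"
proof -
  have "\<forall>i. lorentz (conormal d1 p) (pd i (\<Gamma>s d1 d2) p) = 0"
    using cosh_square_eq[of "p$2"] cosh_square_eq[of "p$3"]
    by (simp add: forall_3 lorentz_def conormal_def pd_\<Gamma>s vector_4) algebra
  then show ?thesis by blast
qed

text \<open>The frame is (v, d1), (s v_t, 0), (s v_w, 0), where v, v_t, v_w are mutually orthogonal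
  with squared lengths -1, 1 and cosh^2 t.\<close>

lemma metric_\<Gamma>s:
  "metric (\<Gamma>s d1 d2) p = (\<chi> i j. if i \<noteq> j then 0 else if i = 1 then d1\<^sup>2 - 1
     else if i = 2 then (p$1)\<^sup>2 else (p$1)\<^sup>2 * (cosh (p$2))\<^sup>2)"
proof -
  let ?X = "\<Gamma>s d1 d2"
  note h = cosh_square_eq[of "p$2"] cosh_square_eq[of "p$3"]
  have "lorentz (pd 1 ?X p) (pd 1 ?X p) = d1\<^sup>2 - 1"
    unfolding lorentz_def pd_\<Gamma>s vector_4 using h by algebra
  moreover have "lorentz (pd 2 ?X p) (pd 2 ?X p) = (p$1)\<^sup>2"
    unfolding lorentz_def pd_\<Gamma>s vector_4 using h by algebra
  moreover have "lorentz (pd 3 ?X p) (pd 3 ?X p) = (p$1)\<^sup>2 * (cosh (p$2))\<^sup>2"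
    unfolding lorentz_def pd_\<Gamma>s vector_4 using h by algebra
  moreover have "lorentz (pd 1 ?X p) (pd 2 ?X p) = 0"
    unfolding lorentz_def pd_\<Gamma>s vector_4 using h by algebra
  moreover have "lorentz (pd 1 ?X p) (pd 3 ?X p) = 0" "lorentz (pd 2 ?X p) (pd 3 ?X p) = 0"
    unfolding lorentz_def pd_\<Gamma>s vector_4 by simp_all
  moreover have "lorentz (pd 2 ?X p) (pd 1 ?X p) = 0" "lorentz (pd 3 ?X p) (pd 1 ?X p) = 0"
      "lorentz (pd 3 ?X p) (pd 2 ?X p) = 0"
    using calculation by (simp_all add: lorentz_def mult.commute)
  ultimately show ?thesis
    by (simp add: metric_def vec_eq_iff forall_3)
qed

text \<open>The determinant is (d1^2 - 1) s^4 cosh^2 t; this is where d1 = 1 and d1 = -1 must be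
  excluded.\<close>

lemma det_metric_\<Gamma>s:
  assumes "d1 \<noteq> 1" "d1 \<noteq> -1" "p \<in> \<Gamma>s_dom"
  shows "det (metric (\<Gamma>s d1 d2) p) \<noteq> 0"
  using assms by (simp add: metric_\<Gamma>s det_3 \<Gamma>s_dom_def power2_eq_1_iff)

lemma open_\<Gamma>s_dom: "open \<Gamma>s_dom"
  unfolding \<Gamma>s_dom_def by (intro open_Collect_neq continuous_intros)

section \<open>Smoothness and Gauss maps\<close>

lemmas smooth_on_intros = smooth_on_add smooth_on_mult smooth_on_const smooth_on_nth
  smooth_on_cosh_sinh_nth smooth_on_bounded_linear[OF bounded_linear_scaleR_left]

lemma smooth_on_\<Gamma>s:
  assumes "open U"
  shows "smooth_on U (\<Gamma>s d1 d2)"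
  unfolding \<Gamma>s_eq[abs_def] vector_4_eq by (intro smooth_on_intros assms)

lemma smooth_on_conormal:
  assumes "open U"
  shows "smooth_on U (conormal d1)"
  unfolding conormal_def[abs_def] vector_4_eq by (intro smooth_on_intros assms)

text \<open>Normalizing \<open>conormal\<close> gives \<epsilon> equal to the sign of 1 - d1^2,
  whence the absolute value under the root.\<close>

lemma gauss_map_exists:
  assumes "d1 \<noteq> 1" "d1 \<noteq> -1"
  shows "gauss_map \<Gamma>s_dom (\<Gamma>s d1 d2) (\<lambda>p. (1 / sqrt \<bar>1 - d1\<^sup>2\<bar>) *\<^sub>R conormal d1 p)"
proof -
  have scale: "lorentz (c *\<^sub>R x) y = c * lorentz x y" "lorentz x (c *\<^sub>R y) = c * lorentz x y" for c x y
    by (simp_all add: lorentz_def algebra_simps)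
  have "1 - d1\<^sup>2 \<noteq> 0" using assms by (simp add: power2_eq_1_iff)
  then have "(1 - d1\<^sup>2) / \<bar>1 - d1\<^sup>2\<bar> \<in> {1, -1}" by (auto simp: abs_if divide_simps)
  moreover have "smooth_on \<Gamma>s_dom (\<lambda>p. (1 / sqrt \<bar>1 - d1\<^sup>2\<bar>) *\<^sub>R conormal d1 p)"
    using smooth_on_bounded_linear[OF bounded_linear_scaleR_right
        smooth_on_conormal[OF open_\<Gamma>s_dom]] .
  ultimately show ?thesis
    by (simp add: gauss_map_def scale lorentz_conormal lorentz_conormal_pd)
qed

lemma orthogonal_\<Gamma>s_conormal:
  assumes "p \<in> \<Gamma>s_dom" and "\<And>i. lorentz n (pd i (\<Gamma>s d1 d2) p) = 0"
  shows "n = n$4 *\<^sub>R conormal d1 p"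
proof -
  let ?c = "cosh (p$2)" and ?s = "sinh (p$2)" and ?C = "cosh (p$3)" and ?S = "sinh (p$3)"
  have "p$1 \<noteq> 0" using assms(1) by (simp add: \<Gamma>s_dom_def)
  have 1: "- n$1 * ?c * ?C + n$2 * ?s + n$3 * ?c * ?S + n$4 * d1 = 0"
    using assms(2)[of 1] by (simp add: lorentz_def pd_\<Gamma>s vector_4 algebra_simps)
  have "p$1 * (- n$1 * ?s * ?C + n$2 * ?c + n$3 * ?s * ?S) = 0"
    using assms(2)[of 2] by (simp add: lorentz_def pd_\<Gamma>s vector_4 algebra_simps)
  then have 2: "- n$1 * ?s * ?C + n$2 * ?c + n$3 * ?s * ?S = 0"
    using \<open>p$1 \<noteq> 0\<close> by simp
  have "p$1 * ?c * (- n$1 * ?S + n$3 * ?C) = 0"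
    using assms(2)[of 3] by (simp add: lorentz_def pd_\<Gamma>s vector_4 algebra_simps)
  then have 3: "- n$1 * ?S + n$3 * ?C = 0"
    using \<open>p$1 \<noteq> 0\<close> by simp
  note h = cosh_square_eq[of "p$2"] cosh_square_eq[of "p$3"]
  have "n$1 = n$4 * (d1 * ?c * ?C)" using 1 2 3 h by algebra
  moreover have "n$2 = n$4 * (d1 * ?s)" using 1 2 3 h by algebra
  moreover have "n$3 = n$4 * (d1 * ?c * ?S)" using 1 2 3 h by algebra
  ultimately show ?thesis
    by (simp add: vec_eq_iff forall_4 conormal_def vector_4)
qed

text \<open>Differentiating the square gives 2 f f' = 0 with f nonzero. This needs no connectedness,
  which matters as \<open>\<Gamma>s_dom\<close> has the two components s > 0 and s < 0.\<close>

lemma has_derivative_zero_of_square_const: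
  fixes f :: "'a::real_normed_vector \<Rightarrow> real"
  assumes "open U" "p \<in> U" "\<And>q. q \<in> U \<Longrightarrow> (f q)\<^sup>2 = c" "c \<noteq> 0"
    and D: "(f has_derivative f') (at p)"
  shows "f' = (\<lambda>h. 0)"
proof -
  have "((\<lambda>q. (f q)\<^sup>2) has_derivative (\<lambda>h. 2 * f p * f' h)) (at p)"
    using D by (auto intro!: derivative_eq_intros)
  then have "((\<lambda>q. c) has_derivative (\<lambda>h. 2 * f p * f' h)) (at p)"
    by (rule has_derivative_transform_within_open[OF _ assms(1,2)]) (rule assms(3))
  then have "(\<lambda>h. 2 * f p * f' h) = (\<lambda>h. 0)"
    using has_derivative_unique has_derivative_const by blast
  moreover have "f p \<noteq> 0" using assms(2-4) by fastforce
  ultimately show ?thesis by (auto simp: fun_eq_iff)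
qed

text \<open>\<open>N\<close> is \<open>N q $ 4\<close> times \<open>conormal\<close>, and the unit
  length fixes the square of that factor to be \<epsilon> / (1 - d1^2). So the factor has zero
  derivative and only \<open>conormal\<close> is differentiated.\<close>

lemma gauss_map_has_derivative:
  assumes "d1 \<noteq> 1" "d1 \<noteq> -1" and N: "gauss_map \<Gamma>s_dom (\<Gamma>s d1 d2) N" and p: "p \<in> \<Gamma>s_dom"
  shows "(N has_derivative (\<lambda>h. N p $ 4 *\<^sub>R frechet_derivative (conormal d1) (at p) h)) (at p)"
proof -
  obtain \<epsilon> where \<epsilon>: "\<epsilon> \<in> {1, -1}" "\<And>q. q \<in> \<Gamma>s_dom \<Longrightarrow> lorentz (N q) (N q) = \<epsilon>"
    using N unfolding gauss_map_def by blast
  have N_eq: "N q = N q $ 4 *\<^sub>R conormal d1 q" if "q \<in> \<Gamma>s_dom" for q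
    using orthogonal_\<Gamma>s_conormal[OF that] N that unfolding gauss_map_def by blast
  have nz: "1 - d1\<^sup>2 \<noteq> 0" using assms by (simp add: power2_eq_1_iff)
  have sq: "(N q $ 4)\<^sup>2 = \<epsilon> / (1 - d1\<^sup>2)" if "q \<in> \<Gamma>s_dom" for q
  proof -
    have "\<epsilon> = lorentz (N q $ 4 *\<^sub>R conormal d1 q) (N q $ 4 *\<^sub>R conormal d1 q)"
      using \<epsilon>(2)[OF that] N_eq[OF that] by simp
    also have "\<dots> = (N q $ 4)\<^sup>2 * lorentz (conormal d1 q) (conormal d1 q)"
      by (simp add: lorentz_def power2_eq_square algebra_simps)
    finally show ?thesis using nz by (simp add: lorentz_conormal field_simps)
  qed
  have "(N has_derivative frechet_derivative N (at p)) (at p)"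
    using N p smooth_on_has_derivative unfolding gauss_map_def by blast
  from bounded_linear.has_derivative[OF bounded_linear_vec_nth this, of 4]
  have "((\<lambda>q. N q $ 4) has_derivative (\<lambda>h. 0)) (at p)"
    using has_derivative_zero_of_square_const[OF open_\<Gamma>s_dom p sq _] \<epsilon>(1) nz by fastforce
  moreover have "(conormal d1 has_derivative frechet_derivative (conormal d1) (at p)) (at p)"
    using smooth_on_has_derivative[OF smooth_on_conormal[OF open_UNIV]] by blast
  ultimately have "((\<lambda>q. N q $ 4 *\<^sub>R conormal d1 q) has_derivative
      (\<lambda>h. N p $ 4 *\<^sub>R frechet_derivative (conormal d1) (at p) h)) (at p)"
    by (auto intro!: derivative_eq_intros)
  then show ?thesis
    by (rule has_derivative_transform_within_open[OF _ open_\<Gamma>s_dom p]) (use N_eq in simp)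
qed

text \<open>\<open>conormal\<close> does not depend on s, and its t and w derivatives d1 v_t and d1
  v_w are d1 / s times those of the parametrization.\<close>

lemma pd_gauss_map:
  assumes "d1 \<noteq> 1" "d1 \<noteq> -1" "gauss_map \<Gamma>s_dom (\<Gamma>s d1 d2) N" "p \<in> \<Gamma>s_dom"
  shows "pd j N p = (if j = 1 then 0 else (N p $ 4 * d1 / p$1) *\<^sub>R pd j (\<Gamma>s d1 d2) p)"
proof -
  have "p$1 \<noteq> 0" using assms(4) by (simp add: \<Gamma>s_dom_def)
  moreover have "pd j N p = N p $ 4 *\<^sub>R pd j (conormal d1) p" for j
    using pd_eq[OF gauss_map_has_derivative[OF assms]] by (simp add: pd_def)
  ultimately have "\<forall>j. pd j N p =
      (if j = 1 then 0 else (N p $ 4 * d1 / p$1) *\<^sub>R pd j (\<Gamma>s d1 d2) p)"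
    by (simp add: forall_3 pd_eq[OF has_derivative_conormal] pd_\<Gamma>s axis_def vec_eq_iff
        forall_4 vector_4)
  then show ?thesis by blast
qed

section \<open>Shape operator and the Hessian along the rulings\<close>

lemma shape_operator_gauss_map:
  assumes "d1 \<noteq> 1" "d1 \<noteq> -1" "gauss_map \<Gamma>s_dom (\<Gamma>s d1 d2) N" "p \<in> \<Gamma>s_dom"
  shows "shape_operator (\<Gamma>s d1 d2) N p =
    (\<chi> i j. if i = j \<and> i \<noteq> 1 then - (N p $ 4 * d1 / p$1) else 0)"
proof (rule shape_operator_eqI[OF det_metric_\<Gamma>s[OF assms(1,2,4)]])
  fix j :: 3
  have "\<forall>j. - pd j N p = (\<Sum>i\<in>UNIV. (\<chi> i j. if i = j \<and> i \<noteq> 1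
      then - (N p $ 4 * d1 / p$1) else 0) $ i $ j *\<^sub>R pd i (\<Gamma>s d1 d2) p)"
    by (simp add: forall_3 sum_3 pd_gauss_map[OF assms])
  then show "- pd j N p = (\<Sum>i\<in>UNIV. (\<chi> i j. if i = j \<and> i \<noteq> 1
      then - (N p $ 4 * d1 / p$1) else 0) $ i $ j *\<^sub>R pd i (\<Gamma>s d1 d2) p)" by blast
qed

text \<open>The first coordinate curves are affinely parametrized geodesics orthogonal to the other
  coordinate directions, so this entry of the Hessian only sees the first partial derivative.\<close>

lemma hessian_op_\<Gamma>s_11:
  assumes "d1 \<noteq> 1" "d1 \<noteq> -1" "p \<in> \<Gamma>s_dom"
    and \<phi>: "\<And>q. q \<in> \<Gamma>s_dom \<Longrightarrow> pd 1 \<phi> q = 0"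
  shows "hessian_op (\<Gamma>s d1 d2) \<phi> p $ 1 $ 1 = 0"
proof -
  let ?X = "\<Gamma>s d1 d2"
  have inv: "matrix_inv (metric ?X q) $ 1 $ j = 0" if "q \<in> \<Gamma>s_dom" "j \<noteq> 1" for q j
    using det_metric_\<Gamma>s[OF assms(1,2) that(1)] that(2)
    by (intro matrix_inv_diagonal) (auto simp: invertible_det_nz metric_\<Gamma>s)
  have grad_1: "grad ?X \<phi> q $ 1 = 0" if "q \<in> \<Gamma>s_dom" for q
    by (simp add: grad_def sum_3 inv[OF that] \<phi>[OF that])
  have "pd 1 (\<lambda>q. grad ?X \<phi> q $ 1) p = pd 1 (\<lambda>q. 0::real) p"
    by (rule pd_cong_open[OF open_\<Gamma>s_dom assms(3)]) (rule grad_1)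
  then have "pd 1 (\<lambda>q. grad ?X \<phi> q $ 1) p = 0"
    by simp
  \<comment> \<open>Only l = 1 survives in the sum, as the inverse metric is diagonal. There the two
    derivatives along s cancel by symmetry of the metric, and the remaining term differentiates the
    constant d1^2 - 1.\<close>
  moreover have "christoffel ?X p 1 1 k = 0" for k
  proof -
    have "metric ?X q $ k $ 1 = metric ?X q $ 1 $ k" for q
      by (simp add: metric_\<Gamma>s)
    moreover have "pd k (\<lambda>q. metric ?X q $ 1 $ 1) p = 0"
      by (simp add: metric_\<Gamma>s)
    ultimately show ?thesis
      by (simp add: christoffel_def sum_3 inv[OF assms(3)])
  qed
  ultimately show ?thesis by (simp add: hessian_op_def cov_deriv_def)
qed

text \<open>All Gauss maps are covered, since the sign can be chosen separately on the two
  components of \<open>\<Gamma>s_dom\<close>; the existence clause keeps this from being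
  vacuous.\<close>

theorem theorem9:
  fixes d1 d2 :: real
  assumes "d1 \<noteq> 1" and "d1 \<noteq> -1"
  shows "nondegenerate_hypersurface \<Gamma>s_dom (\<Gamma>s d1 d2) \<and>
    (\<exists>N. gauss_map \<Gamma>s_dom (\<Gamma>s d1 d2) N) \<and>
    (\<forall>N. gauss_map \<Gamma>s_dom (\<Gamma>s d1 d2) N \<longrightarrow>
      (\<forall>p\<in>\<Gamma>s_dom. L_op_vec 2 (\<Gamma>s d1 d2) N N p = 0))"
proof (intro conjI allI impI ballI)
  show "nondegenerate_hypersurface \<Gamma>s_dom (\<Gamma>s d1 d2)"
    using smooth_on_\<Gamma>s[OF open_\<Gamma>s_dom] det_metric_\<Gamma>s[OF assms]
    by (simp add: nondegenerate_hypersurface_def)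
  show "\<exists>N. gauss_map \<Gamma>s_dom (\<Gamma>s d1 d2) N"
    using gauss_map_exists[OF assms] by blast
next
  fix N p
  assume N: "gauss_map \<Gamma>s_dom (\<Gamma>s d1 d2) N" and p: "p \<in> \<Gamma>s_dom"
  have "pd 1 (\<lambda>q. N q $ a) q = 0" if "q \<in> \<Gamma>s_dom" for a q
  proof -
    note D = gauss_map_has_derivative[OF assms N that]
    have "pd 1 (\<lambda>q. N q $ a) q = pd 1 N q $ a"
      using pd_eq[OF bounded_linear.has_derivative[OF bounded_linear_vec_nth D]] pd_eq[OF D]
      by simp
    then show ?thesis using pd_gauss_map[OF assms N that] by simp
  qed
  \<comment> \<open>P_2 has only its (1, 1) entry, so the trace is a multiple of the (1, 1) entry of
    the Hessian, which vanishes for every coordinate of \<open>N\<close>.\<close>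
  from hessian_op_\<Gamma>s_11[OF assms p this]
  show "L_op_vec 2 (\<Gamma>s d1 d2) N N p = 0"
    by (simp add: L_op_vec_def L_op_def vec_eq_iff trace_def sum_3 matrix_matrix_mult_def
        newton_2_of_umbilic_block[OF shape_operator_gauss_map[OF assms N p]])
qed

end
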